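(* Let $X$ be a complex Banach space, let $T\in\mathcal{L}(X)$ and assume that $T$ has the functional commutant property (respectively, the functional bicommutant property). Then there exist no non-trivial idempotents lying in $\{T\}'$ (respectively, in $\{T\}''$).
   Context: For a complex Banach space $X$, $\mathcal{L}(X)$ is the algebra of bounded linear operators on $X$. For $T\in\mathcal{L}(X)$, $\{T\}'=\{A\in\mathcal{L}(X):AT=TA\}$ and $\{T\}''=\bigcap_{A\in\{T\}'}\{A\}'$. A non-trivial idempotent is $J\in\mathcal{L}(X)$ with $J^2=J$, $J\ne 0$, $J\neq \mathrm{Id}_X$. For $G\subset\mathbb{C}$, $\mathcal{C}(G)$ is the algebra of all continuous functions $f:G\to\mathbb{C}$ with pointwise operations (no topology is considered). $T$ has the functional commutant property (respectively, functional bicommutant property) if there exist a connected subset $G\subset\mathbb{C}$, a subalgebra $\mathcal{A}\subseteq\mathcal{C}(G)$ and an algebra isomorphism $\Phi:\mathcal{A}\to\{T\}'$ (respectively, $\Phi:\mathcal{A}\to\{T\}''$). *)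

theory Defs
  imports Complex_Main
begin

text \<open>
  The distribution only has real Banach spaces. A complex Banach space is a real one with a
  compatible complex scalar multiplication for which the norm is absolutely homogeneous.
\<close>

class complex_banach = banach +
  fixes scaleC :: "complex \<Rightarrow> 'a \<Rightarrow> 'a"  (infixr "*\<^sub>C" 75)
  assumes scaleC_add_right: "a *\<^sub>C (x + y) = a *\<^sub>C x + a *\<^sub>C y"
    and scaleC_add_left: "(a + b) *\<^sub>C x = a *\<^sub>C x + b *\<^sub>C x"
    and scaleC_scaleC: "a *\<^sub>C (b *\<^sub>C x) = (a * b) *\<^sub>C x"
    and scaleC_one: "1 *\<^sub>C x = x"
    and scaleR_scaleC: "r *\<^sub>R x = complex_of_real r *\<^sub>C x"
    and norm_scaleC: "norm (a *\<^sub>C x) = cmod a * norm x"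

instantiation complex :: complex_banach
begin

definition scaleC_complex :: "complex \<Rightarrow> complex \<Rightarrow> complex" where
  "scaleC_complex a x = a * x"

instance
  by standard (simp_all add: scaleC_complex_def algebra_simps norm_mult scaleR_conv_of_real)

end

definition bounded_operators :: "('a::complex_banach \<Rightarrow> 'a) set" where
  "bounded_operators = {A. bounded_linear A \<and> (\<forall>c x. A (c *\<^sub>C x) = c *\<^sub>C A x)}"

definition commutant :: "('a::complex_banach \<Rightarrow> 'a) \<Rightarrow> ('a \<Rightarrow> 'a) set" where
  "commutant T = {A \<in> bounded_operators. A \<circ> T = T \<circ> A}"

definition bicommutant :: "('a::complex_banach \<Rightarrow> 'a) \<Rightarrow> ('a \<Rightarrow> 'a) set" where
  "bicommutant T = (\<Inter>A\<in>commutant T. commutant A)"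

definition nontrivial_idempotent :: "('a::complex_banach \<Rightarrow> 'a) \<Rightarrow> bool" where
  "nontrivial_idempotent J \<longleftrightarrow>
     J \<in> bounded_operators \<and> J \<circ> J = J \<and> J \<noteq> (\<lambda>x. 0) \<and> J \<noteq> id"

text \<open>
  A continuous function on \<open>G\<close> is represented by its extension by \<open>0\<close> to the whole
  plane. This representation is unique, and the pointwise operations on total functions
  preserve it. Continuity is only required on \<open>G\<close>, in the subspace topology.
\<close>

definition continuous_functions :: "complex set \<Rightarrow> (complex \<Rightarrow> complex) set" where
  "continuous_functions G = {f. continuous_on G f \<and> (\<forall>z. z \<notin> G \<longrightarrow> f z = 0)}"

text \<open>Subalgebras need not contain the constant function \<open>1\<close>.\<close>

definition function_subalgebra :: "complex set \<Rightarrow> (complex \<Rightarrow> complex) set \<Rightarrow> bool" where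
  "function_subalgebra G \<A> \<longleftrightarrow>
     \<A> \<subseteq> continuous_functions G \<and>
     (\<lambda>z. 0) \<in> \<A> \<and>
     (\<forall>f\<in>\<A>. \<forall>g\<in>\<A>. (\<lambda>z. f z + g z) \<in> \<A>) \<and>
     (\<forall>c. \<forall>f\<in>\<A>. (\<lambda>z. c * f z) \<in> \<A>) \<and>
     (\<forall>f\<in>\<A>. \<forall>g\<in>\<A>. (\<lambda>z. f z * g z) \<in> \<A>)"

definition algebra_isomorphism ::
  "((complex \<Rightarrow> complex) \<Rightarrow> ('a::complex_banach \<Rightarrow> 'a)) \<Rightarrow>
     (complex \<Rightarrow> complex) set \<Rightarrow> ('a \<Rightarrow> 'a) set \<Rightarrow> bool" where
  "algebra_isomorphism \<Phi> \<A> \<B> \<longleftrightarrow>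
     bij_betw \<Phi> \<A> \<B> \<and>
     (\<forall>f\<in>\<A>. \<forall>g\<in>\<A>. \<Phi> (\<lambda>z. f z + g z) = (\<lambda>x. \<Phi> f x + \<Phi> g x)) \<and>
     (\<forall>c. \<forall>f\<in>\<A>. \<Phi> (\<lambda>z. c * f z) = (\<lambda>x. c *\<^sub>C \<Phi> f x)) \<and>
     (\<forall>f\<in>\<A>. \<forall>g\<in>\<A>. \<Phi> (\<lambda>z. f z * g z) = \<Phi> f \<circ> \<Phi> g)"

definition functional_commutant_property :: "('a::complex_banach \<Rightarrow> 'a) \<Rightarrow> bool" where
  "functional_commutant_property T \<longleftrightarrow>
     (\<exists>G \<A> \<Phi>. connected G \<and> function_subalgebra G \<A> \<and>
        algebra_isomorphism \<Phi> \<A> (commutant T))"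

definition functional_bicommutant_property :: "('a::complex_banach \<Rightarrow> 'a) \<Rightarrow> bool" where
  "functional_bicommutant_property T \<longleftrightarrow>
     (\<exists>G \<A> \<Phi>. connected G \<and> function_subalgebra G \<A> \<and>
        algebra_isomorphism \<Phi> \<A> (bicommutant T))"

end

theory Submission imports Defs begin

text \<open>
  An isomorphism \<open>\<Phi>\<close> from a function algebra onto an operator algebra pulls an idempotent
  operator \<open>J\<close> back to an idempotent function \<open>f\<close>, since \<open>\<Phi>\<close> is injective and multiplicative.
  Pointwise, \<open>f z * f z = f z\<close> leaves only the values \<open>0\<close> and \<open>1\<close>, so \<open>f\<close> is constant on the
  connected set \<open>G\<close>. The constant \<open>0\<close> yields \<open>J = 0\<close>. The constant \<open>1\<close> makes \<open>f\<close> a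
  multiplicative unit for the function algebra, hence \<open>J\<close> a unit for the operator algebra. The
  commutant and the bicommutant both contain the identity operator, so this unit is \<open>id\<close>.
\<close>

lemma continuous_zero_one_valued_constant:
  fixes f :: "'a::topological_space \<Rightarrow> complex"
  assumes "connected G" and "continuous_on G f" and zero_one: "\<And>z. f z = 0 \<or> f z = 1"
  shows "(\<forall>z\<in>G. f z = 0) \<or> (\<forall>z\<in>G. f z = 1)"
proof (rule ccontr)
  assume "\<not> ?thesis"
  then obtain u v where uv: "u \<in> G" "f u = 1" "v \<in> G" "f v = 0"
    using zero_one by blast
  let ?L = "{w::complex. Re w < 1/2}"
  let ?R = "{w::complex. 1/2 < Re w}"
  have "connected (f ` G)"
    using assms by (intro connected_continuous_image)
  moreover have "open ?L" "open ?R"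
    by (intro open_Collect_less continuous_intros)+
  moreover have "?L \<inter> ?R \<inter> f ` G = {}"
    by auto
  moreover have "f ` G \<subseteq> ?L \<union> ?R"
  proof
    fix w assume "w \<in> f ` G"
    then have "w = 0 \<or> w = 1" using zero_one by auto
    then show "w \<in> ?L \<union> ?R" by auto
  qed
  ultimately have "?L \<inter> f ` G = {} \<or> ?R \<inter> f ` G = {}"
    by (rule connectedD)
  moreover have "0 \<in> ?L \<inter> f ` G" "1 \<in> ?R \<inter> f ` G"
    using uv by (auto simp: image_iff intro: bexI[of _ u] bexI[of _ v])
  ultimately show False by blast
qed

lemma scaleC_zero_left: "0 *\<^sub>C x = (0 :: 'a::complex_banach)"
  using scaleR_scaleC[of 0 x] by simp

lemma id_in_commutant: "id \<in> commutant T"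
  by (auto simp: commutant_def bounded_operators_def id_def)

lemma id_in_bicommutant: "id \<in> bicommutant T"
  by (auto simp: bicommutant_def id_in_commutant)

text \<open>
  The case distinction is on the constant value of the function that represents \<open>J\<close>. For the
  value \<open>1\<close>, that function is \<open>1\<close> on \<open>G\<close> but \<open>0\<close> elsewhere; it is still a unit, because the
  members of \<open>\<A>\<close> vanish outside \<open>G\<close>.
\<close>

lemma idempotent_trivial_if_isomorphic_to_functions:
  fixes J :: "'a::complex_banach \<Rightarrow> 'a"
  assumes conn: "connected G" and alg: "function_subalgebra G \<A>"
    and iso: "algebra_isomorphism \<Phi> \<A> \<B>"
    and "id \<in> \<B>" and "J \<in> \<B>" and idem: "J \<circ> J = J"
  shows "J = (\<lambda>x. 0) \<or> J = id"
proof -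
  have inj: "inj_on \<Phi> \<A>" and surj: "\<Phi> ` \<A> = \<B>"
    and mult: "\<And>f g. f \<in> \<A> \<Longrightarrow> g \<in> \<A> \<Longrightarrow> \<Phi> (\<lambda>z. f z * g z) = \<Phi> f \<circ> \<Phi> g"
    and scale: "\<And>c f. f \<in> \<A> \<Longrightarrow> \<Phi> (\<lambda>z. c * f z) = (\<lambda>x. c *\<^sub>C \<Phi> f x)"
    using iso by (auto simp: algebra_isomorphism_def bij_betw_def)
  have closed: "\<And>f g. f \<in> \<A> \<Longrightarrow> g \<in> \<A> \<Longrightarrow> (\<lambda>z. f z * g z) \<in> \<A>"
    and cont: "\<And>f. f \<in> \<A> \<Longrightarrow> continuous_on G f"
    and supp: "\<And>f z. f \<in> \<A> \<Longrightarrow> z \<notin> G \<Longrightarrow> f z = 0"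
    using alg by (auto simp: function_subalgebra_def continuous_functions_def)
  obtain f where f: "f \<in> \<A>" "\<Phi> f = J"
    using \<open>J \<in> \<B>\<close> surj by (metis imageE)
  obtain e where e: "e \<in> \<A>" "\<Phi> e = id"
    using \<open>id \<in> \<B>\<close> surj by (metis imageE)
  have "\<Phi> (\<lambda>z. f z * f z) = \<Phi> f"
    using mult[OF f(1) f(1)] idem by (simp only: f(2))
  then have "(\<lambda>z. f z * f z) = f"
    using inj closed f(1) by (meson inj_onD)
  then have "f z * f z = f z" for z
    by (rule fun_cong)
  then have "f z = 0 \<or> f z = 1" for z
    by (metis mult_cancel_right1)
  with conn cont f(1) consider "\<forall>z\<in>G. f z = 0" | "\<forall>z\<in>G. f z = 1"
    using continuous_zero_one_valued_constant by blast
  then show ?thesis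
  proof cases
    case 1
    then have zero: "(\<lambda>z. 0 * f z) = f"
      using supp[OF f(1)] by (intro ext) (metis mult_zero_left)
    have "J = (\<lambda>x. 0 *\<^sub>C J x)"
      using scale[OF f(1), of 0] by (simp only: zero f(2))
    also have "\<dots> = (\<lambda>x. 0)"
      by (simp add: scaleC_zero_left)
    finally show ?thesis ..
  next
    case 2
    then have unit: "(\<lambda>z. f z * e z) = e"
      using supp[OF e(1)] by (intro ext) (metis mult_1 mult_zero_right)
    have "J = id"
      using mult[OF f(1) e(1)] unfolding unit f(2) e(2) by simp
    then show ?thesis ..
  qed
qed

theorem theorem2p2:
  fixes T :: "'a::complex_banach \<Rightarrow> 'a"
  assumes "T \<in> bounded_operators"
  shows "(functional_commutant_property T \<longrightarrow>
            \<not> (\<exists>J\<in>commutant T. nontrivial_idempotent J)) \<and>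
         (functional_bicommutant_property T \<longrightarrow>
            \<not> (\<exists>J\<in>bicommutant T. nontrivial_idempotent J))"
proof -
  have trivial: "\<not> (\<exists>J\<in>\<B>. nontrivial_idempotent J)"
    if ex: "\<exists>G \<A> \<Phi>. connected G \<and> function_subalgebra G \<A> \<and> algebra_isomorphism \<Phi> \<A> \<B>"
      and id: "id \<in> \<B>" for \<B> :: "('a \<Rightarrow> 'a) set"
  proof
    assume "\<exists>J\<in>\<B>. nontrivial_idempotent J"
    then obtain J where J: "J \<in> \<B>" "nontrivial_idempotent J" ..
    obtain G \<A> \<Phi> where
      "connected G" "function_subalgebra G \<A>" "algebra_isomorphism \<Phi> \<A> \<B>"
      using ex by (elim exE conjE)
    moreover have "J \<circ> J = J"
      using J(2) by (simp add: nontrivial_idempotent_def)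
    ultimately have "J = (\<lambda>x. 0) \<or> J = id"
      using id J(1) by (intro idempotent_trivial_if_isomorphic_to_functions)
    with J(2) show False
      by (simp add: nontrivial_idempotent_def)
  qed
  show ?thesis
    unfolding functional_commutant_property_def functional_bicommutant_property_def
    by (intro conjI impI trivial id_in_commutant id_in_bicommutant)
qed

end
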